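(* Consider the nonlinear model predictive control (NMPC) problem and the static optimal operation problem defined in the context, with stator resistance $r_s = 0$, state weight $Q=\mathrm{Diag}(\gamma,\beta)$ and input weight $W=\gamma I_{2}$, where $\gamma,\beta$ are positive constants. Suppose perfect tracking is achieved, i.e. there is $M$ such that the dc voltage (first state component) equals the reference $v_{dc}^*$ at all closed-loop time steps greater than $M$, and consider the NMPC problem solved at such a time step in steady state: the load current is a constant $d_k=i_L$ over the horizon and the current state is $\bar x=(\bar x_1,\bar x_2)^T$ with $\bar x_1=v_{dc}^*$. Let $$P_e := -\left(\frac{v_{dc}^2}{R}+v_{dc}\, i_L\right),\qquad v_{dc}=v_{dc}^*.$$ Assume that the NMPC problem has an optimal solution that is constant over the horizon (steady state, $x_{k+1}=x_k$), namely $x_k = x^*$ for $k=0,\dots,N$ and $u_k=u^*$ for $k=0,\dots,N-1$, where $x^*=\bar x$ and $u^*\in\mathbb{R}^2$. Then $u^*=(i_d,i_q)^T$ is also an optimal solution of the static problem with this $P_e$ and with $v_{dc}=v_{dc}^*$.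
   Context: Parameters (real constants): dc side resistance $R>0$ and capacitance $C>0$; inductances $L_d,L_q>0$; magnet flux linkage $\lambda_m$; rotor electrical frequency $\omega_r$; stator resistance $r_s$; dc load current $i_L$; dc voltage reference $v_{dc}^*>0$; limits $I_{\mathrm{peak}}>0$ and $0<V_{\mathrm{dc\text{-}min}}\le V_{\mathrm{dc\text{-}max}}$; time step $T_s>0$; horizon $N\ge 1$ (an integer). Continuous-time model. The state is $x=(v_{dc},e_{\mathrm{int}})^T$, the input is $u=(i_d,i_q)^T$ and the disturbance is $d=i_L$. The dynamics $\dot x=f_c(x,u,d)$ are $$\dot v_{dc} = -\frac{1}{RC}v_{dc}-\frac1C i_L+\frac{3}{2C}\frac{1}{v_{dc}}\Big(-r_s(i_d^2+i_q^2)+\omega_r(L_q-L_d)i_q i_d-\omega_r\lambda_m i_q\Big),\qquad \dot e_{\mathrm{int}}=-v_{dc}+v_{dc}^*.$$ Forward Euler discretization: $f_d(x,u,d)=x+T_s f_c(x,u,d)$. NMPC problem. Write $x_{1,k}$ for the first component of $x_k\in\mathbb{R}^2$, and $u_{1,k},u_{2,k}$ for the components of $u_k\in\mathbb{R}^2$. Let $x_{\mathrm{ref}}=(v_{dc}^*,0)^T$. Given the current state $\bar x$ and disturbances $d_k$, minimize over $x_0,\dots,x_N$ and $u_0,\dots,u_{N-1}$ $$\sum_{k=0}^{N-1}\Big[(x_k-x_{\mathrm{ref}})^TQ(x_k-x_{\mathrm{ref}})+u_k^TWu_k\Big]+(x_N-x_{\mathrm{ref}})^TQ(x_N-x_{\mathrm{ref}})$$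 subject to $x_0=\bar x$; for $k=0,\dots,N-1$: $x_{k+1}=f_d(x_k,u_k,d_k)$, $\|u_k\|_2^2\le I_{\mathrm{peak}}^2$, and $(\omega_rL_qu_{2,k})^2+(\omega_rL_du_{1,k}+\omega_r\lambda_m)^2\le (x_{1,k}/2)^2$; and for $k=1,\dots,N$: $V_{\mathrm{dc\text{-}min}}\le x_{1,k}\le V_{\mathrm{dc\text{-}max}}$. Static optimal operation problem. For given $P_e$ and $v_{dc}$, minimize $i_d^2+i_q^2$ over $(i_d,i_q)\in\mathbb{R}^2$ subject to $$\tfrac32\omega_r\big(\lambda_m i_q+(L_d-L_q)i_qi_d\big)=P_e,\qquad i_d^2+i_q^2\le I_{\mathrm{peak}}^2,\qquad (\omega_rL_qi_q)^2+(\omega_rL_di_d+\omega_r\lambda_m)^2\le\Big(\frac{v_{dc}}{2}\Big)^2.$$ *)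

theory Defs
  imports "HOL-Analysis.Analysis"
begin

record drive =
  R_dc :: real
  C_dc :: real
  L_d :: real
  L_q :: real
  flux :: real       (* magnet flux linkage, lambda_m *)
  omega :: real      (* rotor electrical frequency *)
  r_s :: real        (* stator resistance *)
  v_ref :: real      (* dc voltage reference, v_dc^* *)
  I_peak :: real
  V_min :: real
  V_max :: real
  T_s :: real
  horizon :: nat

definition valid_drive :: "drive \<Rightarrow> bool" where
  "valid_drive p \<longleftrightarrow>
     R_dc p > 0 \<and> C_dc p > 0 \<and> L_d p > 0 \<and> L_q p > 0 \<and> v_ref p > 0 \<and> I_peak p > 0 \<and>
     0 < V_min p \<and> V_min p \<le> V_max p \<and> T_s p > 0 \<and> horizon p \<ge> 1"

(* State x = (v_dc, e_int), input u = (i_d, i_q), disturbance d = i_L. *)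

definition f_c :: "drive \<Rightarrow> real^2 \<Rightarrow> real^2 \<Rightarrow> real \<Rightarrow> real^2" where
  "f_c p x u d = vector
     [- (1 / (R_dc p * C_dc p)) * x$1 - (1 / C_dc p) * d
        + 3 / (2 * C_dc p) * (1 / x$1)
          * (- r_s p * ((u$1)\<^sup>2 + (u$2)\<^sup>2)
             + omega p * (L_q p - L_d p) * u$2 * u$1
             - omega p * flux p * u$2),
      - x$1 + v_ref p]"

definition f_d :: "drive \<Rightarrow> real^2 \<Rightarrow> real^2 \<Rightarrow> real \<Rightarrow> real^2" where
  "f_d p x u d = x + T_s p *\<^sub>R f_c p x u d"

definition x_ref :: "drive \<Rightarrow> real^2" where
  "x_ref p = vector [v_ref p, 0]"

definition current_limit :: "drive \<Rightarrow> real^2 \<Rightarrow> bool" where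
  "current_limit p u \<longleftrightarrow> (norm u)\<^sup>2 \<le> (I_peak p)\<^sup>2"

definition voltage_limit :: "drive \<Rightarrow> real \<Rightarrow> real^2 \<Rightarrow> bool" where
  "voltage_limit p v u \<longleftrightarrow>
     (omega p * L_q p * u$2)\<^sup>2 + (omega p * L_d p * u$1 + omega p * flux p)\<^sup>2 \<le> (v / 2)\<^sup>2"

definition quad_form :: "real^2^2 \<Rightarrow> real^2 \<Rightarrow> real" where
  "quad_form A y = y \<bullet> (A *v y)"

definition Diag2 :: "real \<Rightarrow> real \<Rightarrow> real^2^2" where
  "Diag2 a b = vector [vector [a, 0], vector [0, b]]"

(* Trajectories are total functions on the naturals; only x 0, ..., x N and
   u 0, ..., u (N - 1), and only d 0, ..., d (N - 1), are ever inspected. *)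

definition nmpc_cost ::
  "drive \<Rightarrow> real^2^2 \<Rightarrow> real^2^2 \<Rightarrow> (nat \<Rightarrow> real^2) \<Rightarrow> (nat \<Rightarrow> real^2) \<Rightarrow> real" where
  "nmpc_cost p Q W x u =
     (\<Sum>k<horizon p. quad_form Q (x k - x_ref p) + quad_form W (u k))
     + quad_form Q (x (horizon p) - x_ref p)"

definition nmpc_feasible ::
  "drive \<Rightarrow> real^2 \<Rightarrow> (nat \<Rightarrow> real) \<Rightarrow> (nat \<Rightarrow> real^2) \<Rightarrow> (nat \<Rightarrow> real^2) \<Rightarrow> bool" where
  "nmpc_feasible p xbar d x u \<longleftrightarrow>
     x 0 = xbar \<and>
     (\<forall>k<horizon p. x (Suc k) = f_d p (x k) (u k) (d k)
        \<and> current_limit p (u k) \<and> voltage_limit p (x k $ 1) (u k)) \<and>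
     (\<forall>k\<in>{1..horizon p}. V_min p \<le> x k $ 1 \<and> x k $ 1 \<le> V_max p)"

definition nmpc_optimal ::
  "drive \<Rightarrow> real^2^2 \<Rightarrow> real^2^2 \<Rightarrow> real^2 \<Rightarrow> (nat \<Rightarrow> real) \<Rightarrow>
   (nat \<Rightarrow> real^2) \<Rightarrow> (nat \<Rightarrow> real^2) \<Rightarrow> bool" where
  "nmpc_optimal p Q W xbar d x u \<longleftrightarrow>
     nmpc_feasible p xbar d x u \<and>
     (\<forall>x' u'. nmpc_feasible p xbar d x' u' \<longrightarrow> nmpc_cost p Q W x u \<le> nmpc_cost p Q W x' u')"

(* Receding horizon: at step t the problem is solved from the current state X t with the
   disturbance forecast D t 0, D t 1, ..., and the first input is applied to the plant.
   The plant's one-step map is a parameter: the nominal closed loop has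
   plant t x u = f_d p x u (D t 0), but the sampled continuous-time system is also covered. *)

definition nmpc_closed_loop ::
  "drive \<Rightarrow> real^2^2 \<Rightarrow> real^2^2 \<Rightarrow> (nat \<Rightarrow> real^2 \<Rightarrow> real^2 \<Rightarrow> real^2) \<Rightarrow>
   (nat \<Rightarrow> nat \<Rightarrow> real) \<Rightarrow> (nat \<Rightarrow> real^2) \<Rightarrow> bool" where
  "nmpc_closed_loop p Q W plant D X \<longleftrightarrow>
     (\<forall>t. \<exists>x u. nmpc_optimal p Q W (X t) (D t) x u \<and> X (Suc t) = plant t (X t) (u 0))"

definition static_feasible :: "drive \<Rightarrow> real \<Rightarrow> real \<Rightarrow> real^2 \<Rightarrow> bool" where
  "static_feasible p P_e v_dc u \<longleftrightarrow>
     3 / 2 * omega p * (flux p * u$2 + (L_d p - L_q p) * u$2 * u$1) = P_e \<and>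
     (u$1)\<^sup>2 + (u$2)\<^sup>2 \<le> (I_peak p)\<^sup>2 \<and>
     voltage_limit p v_dc u"

definition static_optimal :: "drive \<Rightarrow> real \<Rightarrow> real \<Rightarrow> real^2 \<Rightarrow> bool" where
  "static_optimal p P_e v_dc u \<longleftrightarrow>
     static_feasible p P_e v_dc u \<and>
     (\<forall>u'. static_feasible p P_e v_dc u' \<longrightarrow> (u$1)\<^sup>2 + (u$2)\<^sup>2 \<le> (u'$1)\<^sup>2 + (u'$2)\<^sup>2)"

end

theory Submission
  imports Defs
begin

text \<open>
  On the line where the voltage equals its reference, being an equilibrium of the
  discretized dynamics is the same as the static torque-power equation. Hence every static
  feasible input, held constant, gives an admissible competitor with the same constant state
  trajectory, and the cost difference is a positive multiple of the difference of the squared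
  current norms.
\<close>

lemma norm_sq_vec2: "(norm (u :: real^2))\<^sup>2 = (u$1)\<^sup>2 + (u$2)\<^sup>2"
  by (simp add: norm_eq_sqrt_inner inner_vec_def sum_2 power2_eq_square)

lemma quad_form_scaled_identity: "quad_form (c *\<^sub>R mat 1) y = c * (norm y)\<^sup>2"
  by (simp add: quad_form_def scaleR_matrix_vector_assoc [symmetric] power2_norm_eq_inner)

text \<open>As \<open>T_s p\<close> is nonzero, fixed points of the Euler map are zeros of
  \<open>f_c\<close>. At the reference voltage the integrator component vanishes by itself, and with
  \<open>r_s p = 0\<close> the voltage component, multiplied by \<open>C_dc p * v_ref p\<close>, is
  the balance of dc and electrical power.\<close>

lemma f_d_fixed_point_iff_power_balance:
  assumes "valid_drive p" "r_s p = 0" "x $ 1 = v_ref p"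
  shows "f_d p x u d = x \<longleftrightarrow>
    3 / 2 * omega p * (flux p * u$2 + (L_d p - L_q p) * u$2 * u$1)
      = - ((v_ref p)\<^sup>2 / R_dc p + v_ref p * d)"
proof -
  have pos: "R_dc p > 0" "C_dc p > 0" "v_ref p > 0" "T_s p > 0"
    using assms(1) by (auto simp: valid_drive_def)
  have "f_d p x u d = x \<longleftrightarrow> f_c p x u d = 0"
    using pos by (simp add: f_d_def)
  also have "\<dots> \<longleftrightarrow> - (1 / (R_dc p * C_dc p)) * v_ref p - (1 / C_dc p) * d
      + 3 / (2 * C_dc p) * (1 / v_ref p)
        * (omega p * (L_q p - L_d p) * u$2 * u$1 - omega p * flux p * u$2) = 0"
    using assms by (simp add: f_c_def vec_eq_iff forall_2)
  \<comment> \<open>Over the common denominator \<open>C_dc p * v_ref p\<close> the numerator is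
    exactly the power mismatch.\<close>
  also have "- (1 / (R_dc p * C_dc p)) * v_ref p - (1 / C_dc p) * d
      + 3 / (2 * C_dc p) * (1 / v_ref p)
        * (omega p * (L_q p - L_d p) * u$2 * u$1 - omega p * flux p * u$2)
      = (- ((v_ref p)\<^sup>2 / R_dc p + v_ref p * d)
          - 3 / 2 * omega p * (flux p * u$2 + (L_d p - L_q p) * u$2 * u$1))
        / (C_dc p * v_ref p)"
    using pos by (simp add: field_simps power2_eq_square)
  also have "\<dots> = 0 \<longleftrightarrow> 3 / 2 * omega p * (flux p * u$2 + (L_d p - L_q p) * u$2 * u$1)
      = - ((v_ref p)\<^sup>2 / R_dc p + v_ref p * d)"
    using pos by auto
  finally show ?thesis .
qed

text \<open>The dynamics constraint turns into the power equation, and the two input limits carry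
  over unchanged. The static problem has no counterpart of the bounds \<open>V_min p\<close> and
  \<open>V_max p\<close>, so they are assumed for the reference.\<close>

lemma nmpc_feasible_constant_iff_static_feasible:
  assumes "valid_drive p" "r_s p = 0" "xbar $ 1 = v_ref p"
    and "\<forall>k<horizon p. d k = i_L"
    and "V_min p \<le> v_ref p" "v_ref p \<le> V_max p"
  shows "nmpc_feasible p xbar d (\<lambda>_. xbar) (\<lambda>_. u) \<longleftrightarrow>
    static_feasible p (- ((v_ref p)\<^sup>2 / R_dc p + v_ref p * i_L)) (v_ref p) u"
proof -
  have "horizon p \<ge> 1"
    using assms(1) by (simp add: valid_drive_def)
  \<comment> \<open>For constant trajectories all stages impose the same conditions;
    \<open>horizon p \<ge> 1\<close> ensures that there is at least one stage.\<close>
  then have "nmpc_feasible p xbar d (\<lambda>_. xbar) (\<lambda>_. u) \<longleftrightarrow>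
      f_d p xbar u i_L = xbar \<and> current_limit p u \<and> voltage_limit p (v_ref p) u"
    using assms(3-) by (fastforce simp: nmpc_feasible_def)
  then show ?thesis
    using f_d_fixed_point_iff_power_balance [OF assms(1-3)]
    by (simp add: static_feasible_def current_limit_def norm_sq_vec2)
qed

text \<open>Only the last summand depends on the input, so with the state fixed, comparing costs
  means comparing squared currents.\<close>

lemma nmpc_cost_constant:
  "nmpc_cost p Q (\<gamma> *\<^sub>R mat 1) (\<lambda>_. x) (\<lambda>_. u) =
    (real (horizon p) + 1) * quad_form Q (x - x_ref p)
    + real (horizon p) * \<gamma> * ((u$1)\<^sup>2 + (u$2)\<^sup>2)"
  by (simp add: nmpc_cost_def quad_form_scaled_identity norm_sq_vec2 algebra_simps)

text \<open>The given optimal trajectory is known to be constant only up to the horizon. This lemma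
  and \<open>nmpc_cost_cong\<close> allow it to be replaced by globally constant functions.\<close>

lemma nmpc_feasible_cong:
  assumes "\<forall>k\<le>horizon p. x k = x' k" "\<forall>k<horizon p. u k = u' k"
  shows "nmpc_feasible p xbar d x u \<longleftrightarrow> nmpc_feasible p xbar d x' u'"
  using assms by (auto simp: nmpc_feasible_def Suc_le_eq)

lemma nmpc_cost_cong:
  assumes "\<forall>k\<le>horizon p. x k = x' k" "\<forall>k<horizon p. u k = u' k"
  shows "nmpc_cost p Q W x u = nmpc_cost p Q W x' u'"
  using assms by (auto simp: nmpc_cost_def)

theorem proposition3:
  fixes p :: drive
    and \<gamma> \<beta> i_L P_e v_dc :: real
    and Q W :: "real^2^2"
    and plant :: "nat \<Rightarrow> real^2 \<Rightarrow> real^2 \<Rightarrow> real^2"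
    and D :: "nat \<Rightarrow> nat \<Rightarrow> real"
    and X x u :: "nat \<Rightarrow> real^2"
    and M n :: nat
    and xbar xstar ustar :: "real^2"
  assumes params: "valid_drive p" "r_s p = 0"
    and weights: "\<gamma> > 0" "\<beta> > 0" "Q = Diag2 \<gamma> \<beta>" "W = \<gamma> *\<^sub>R mat 1"
    and closed_loop: "nmpc_closed_loop p Q W plant D X"
    and perfect_tracking: "\<forall>t>M. X t $ 1 = v_ref p"
    and current_step: "n > M" "xbar = X n"
    and constant_load: "\<forall>k<horizon p. D n k = i_L"
    and optimal: "nmpc_optimal p Q W xbar (D n) x u"
    and steady_state: "xstar = xbar" "\<forall>k\<le>horizon p. x k = xstar" "\<forall>k<horizon p. u k = ustar"
    and static_data: "v_dc = v_ref p" "P_e = - (v_dc\<^sup>2 / R_dc p + v_dc * i_L)"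
  shows "static_optimal p P_e v_dc ustar"
proof -
  have N: "horizon p \<ge> 1"
    using params(1) by (simp add: valid_drive_def)
  have xbar1: "xbar $ 1 = v_ref p"
    using perfect_tracking current_step by simp
  have const: "\<forall>k\<le>horizon p. x k = xbar" "\<forall>k<horizon p. u k = ustar"
    using steady_state by auto
  have feas: "nmpc_feasible p xbar (D n) (\<lambda>_. xbar) (\<lambda>_. ustar)"
    using optimal nmpc_feasible_cong [OF const] by (simp add: nmpc_optimal_def)
  \<comment> \<open>The initial state is not bounded directly; the bounds come from stage 1, where
    the state is again \<open>xbar\<close>.\<close>
  then have V: "V_min p \<le> v_ref p" "v_ref p \<le> V_max p"
    using N xbar1 by (auto simp: nmpc_feasible_def)
  note static_iff = nmpc_feasible_constant_iff_static_feasible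
    [OF params xbar1 constant_load V, folded static_data(1), folded static_data(2)]
  have "(ustar$1)\<^sup>2 + (ustar$2)\<^sup>2 \<le> (u'$1)\<^sup>2 + (u'$2)\<^sup>2"
    if "static_feasible p P_e v_dc u'" for u'
  proof -
    have "nmpc_feasible p xbar (D n) (\<lambda>_. xbar) (\<lambda>_. u')"
      using that static_iff by simp
    then have "nmpc_cost p Q W (\<lambda>_. xbar) (\<lambda>_. ustar) \<le> nmpc_cost p Q W (\<lambda>_. xbar) (\<lambda>_. u')"
      using optimal nmpc_cost_cong [OF const] by (simp add: nmpc_optimal_def)
    \<comment> \<open>The state costs cancel, and the remaining factor
      \<open>real (horizon p) * \<gamma>\<close> is positive.\<close>
    then show ?thesis
      using N weights(1) by (simp add: weights(4) nmpc_cost_constant)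
  qed
  then show ?thesis
    using feas static_iff by (simp add: static_optimal_def)
qed

end
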